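(* Let $\mathcal{A}$ be an additive category and let $\mathbf{G}=(G,\delta,\epsilon)$ be a comonad on $\mathcal{A}$ which respects its additive structure (i.e. $G$ is an additive functor). Then the natural transformation $\tau=\tau^G:GG\Rightarrow GG$ defined by $$\tau_M:=\delta_M\circ\epsilon_{GM}+\delta_M\circ G(\epsilon_M)-1_{GGM}$$ is a symmetry of $\mathbf{G}$.
   Context: A comonad $(G,\delta,\epsilon)$ on $\mathcal{A}$ consists of an endofunctor $G$ and natural transformations $\delta:G\Rightarrow GG$, $\epsilon:G\Rightarrow\mathrm{Id}_{\mathcal{A}}$ satisfying $\delta_{G}\circ\delta=G(\delta)\circ\delta$ and $\epsilon_{G}\circ\delta=G(\epsilon)\circ\delta=1_{G}$. For a natural transformation $\alpha$, $\alpha_G$ has components $\alpha_{GM}$ and $G(\alpha)$ has components $G(\alpha_M)$. A natural transformation $t:GG\Rightarrow GG$ is a symmetry of $\mathbf{G}$ if it satisfies the quantum Yang–Baxter equation $G(t_M)\circ t_{GM}\circ G(t_M)=t_{GM}\circ G(t_M)\circ t_{GM}$ for all objects $M$, and $$t^2=1_{GG},\quad t\delta=\delta,\quad \epsilon_Gt=G(\epsilon),\quad \delta_Gt=G(t)\,t_G\,G(\delta).$$ *)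

theory Defs
  imports "HOL-Algebra.Ring"
begin

text \<open>
  Composition is written in applicative order: \<open>g \<cdot>\<^bsub>A\<^esub> f\<close> is ``first \<open>f\<close>, then \<open>g\<close>''. All operations
  are total functions; nothing is assumed about their values outside \<open>Obj A\<close>, \<open>Arr A\<close>, or on
  non-composable pairs.
\<close>

record ('o, 'm) category =
  Obj :: "'o set"
  Arr :: "'m set"
  Dom :: "'m \<Rightarrow> 'o"
  Cod :: "'m \<Rightarrow> 'o"
  Id :: "'o \<Rightarrow> 'm"
  Comp :: "'m \<Rightarrow> 'm \<Rightarrow> 'm"  (infixr "\<cdot>\<index>" 70)

definition Hom :: "('o, 'm, 'x) category_scheme \<Rightarrow> 'o \<Rightarrow> 'o \<Rightarrow> 'm set" where
  "Hom A X Y = {f \<in> Arr A. Dom A f = X \<and> Cod A f = Y}"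

locale category =
  fixes A :: "('o, 'm, 'x) category_scheme" (structure)
  assumes Dom_in: "f \<in> Arr A \<Longrightarrow> Dom A f \<in> Obj A"
    and Cod_in: "f \<in> Arr A \<Longrightarrow> Cod A f \<in> Obj A"
    and Id_in: "X \<in> Obj A \<Longrightarrow> Id A X \<in> Hom A X X"
    and Comp_in: "f \<in> Hom A X Y \<Longrightarrow> g \<in> Hom A Y Z \<Longrightarrow> g \<cdot> f \<in> Hom A X Z"
    and Comp_Id: "f \<in> Hom A X Y \<Longrightarrow> f \<cdot> Id A X = f"
    and Id_Comp: "f \<in> Hom A X Y \<Longrightarrow> Id A Y \<cdot> f = f"
    and Comp_assoc: "f \<in> Hom A W X \<Longrightarrow> g \<in> Hom A X Y \<Longrightarrow> h \<in> Hom A Y Z \<Longrightarrow>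
      (h \<cdot> g) \<cdot> f = h \<cdot> (g \<cdot> f)"

record ('o1, 'm1, 'o2, 'm2) functor_data =
  OMap :: "'o1 \<Rightarrow> 'o2"
  AMap :: "'m1 \<Rightarrow> 'm2"

definition id_functor :: "('o, 'm, 'o, 'm) functor_data" where
  "id_functor = \<lparr>OMap = (\<lambda>X. X), AMap = (\<lambda>f. f)\<rparr>"

definition comp_functor ::
  "('o2, 'm2, 'o3, 'm3) functor_data \<Rightarrow> ('o1, 'm1, 'o2, 'm2) functor_data
    \<Rightarrow> ('o1, 'm1, 'o3, 'm3) functor_data" where
  "comp_functor H F = \<lparr>OMap = OMap H \<circ> OMap F, AMap = AMap H \<circ> AMap F\<rparr>"

locale cat_functor = A: category A + B: category B
  for A :: "('o1, 'm1, 'x) category_scheme" and B :: "('o2, 'm2, 'y) category_scheme" +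
  fixes F :: "('o1, 'm1, 'o2, 'm2) functor_data"
  assumes OMap_in: "X \<in> Obj A \<Longrightarrow> OMap F X \<in> Obj B"
    and AMap_in: "f \<in> Hom A X Y \<Longrightarrow> AMap F f \<in> Hom B (OMap F X) (OMap F Y)"
    and AMap_Id: "X \<in> Obj A \<Longrightarrow> AMap F (Id A X) = Id B (OMap F X)"
    and AMap_Comp: "f \<in> Hom A X Y \<Longrightarrow> g \<in> Hom A Y Z \<Longrightarrow>
      AMap F (g \<cdot>\<^bsub>A\<^esub> f) = AMap F g \<cdot>\<^bsub>B\<^esub> AMap F f"

locale nat_trans = F: cat_functor A B F + H: cat_functor A B H
  for A :: "('o1, 'm1, 'x) category_scheme" and B :: "('o2, 'm2, 'y) category_scheme"
    and F H :: "('o1, 'm1, 'o2, 'm2) functor_data" +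
  fixes t :: "'o1 \<Rightarrow> 'm2"
  assumes component_in: "X \<in> Obj A \<Longrightarrow> t X \<in> Hom B (OMap F X) (OMap H X)"
    and naturality: "f \<in> Hom A X Y \<Longrightarrow> t Y \<cdot>\<^bsub>B\<^esub> AMap F f = AMap H f \<cdot>\<^bsub>B\<^esub> t X"

text \<open>
  \<open>Add A f g\<close> is meaningful only for parallel arrows; \<open>Zero A X Y\<close> is the zero arrow from \<open>X\<close> to \<open>Y\<close>.
\<close>

record ('o, 'm) additive_structure = "('o, 'm) category" +
  Add :: "'m \<Rightarrow> 'm \<Rightarrow> 'm"
  Zero :: "'o \<Rightarrow> 'o \<Rightarrow> 'm"

text \<open>
  A hom-set as an additive abelian group. The library's \<open>abelian_group\<close> and its operations \<open>\<oplus>\<close>, \<open>\<ominus>\<close>,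
  \<open>\<zero>\<close> live on the ring record but do not depend on the fields \<open>mult\<close> and \<open>one\<close>, which are left
  unspecified here.
\<close>

definition hom_group :: "('o, 'm, 'x) additive_structure_scheme \<Rightarrow> 'o \<Rightarrow> 'o \<Rightarrow> 'm ring" where
  "hom_group A X Y = \<lparr>carrier = Hom A X Y, monoid.mult = undefined, one = undefined,
     zero = Zero A X Y, add = Add A\<rparr>"

locale preadditive_category = category A
  for A :: "('o, 'm, 'x) additive_structure_scheme" (structure) +
  assumes hom_abelian_group: "X \<in> Obj A \<Longrightarrow> Y \<in> Obj A \<Longrightarrow> abelian_group (hom_group A X Y)"
    and Comp_add_left: "f \<in> Hom A X Y \<Longrightarrow> g \<in> Hom A Y Z \<Longrightarrow> h \<in> Hom A Y Z \<Longrightarrow>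
      (g \<oplus>\<^bsub>hom_group A Y Z\<^esub> h) \<cdot> f = (g \<cdot> f) \<oplus>\<^bsub>hom_group A X Z\<^esub> (h \<cdot> f)"
    and Comp_add_right: "f \<in> Hom A X Y \<Longrightarrow> g \<in> Hom A X Y \<Longrightarrow> h \<in> Hom A Y Z \<Longrightarrow>
      h \<cdot> (f \<oplus>\<^bsub>hom_group A X Y\<^esub> g) = (h \<cdot> f) \<oplus>\<^bsub>hom_group A X Z\<^esub> (h \<cdot> g)"

definition zero_object :: "('o, 'm, 'x) category_scheme \<Rightarrow> 'o \<Rightarrow> bool" where
  "zero_object A Z \<longleftrightarrow> Z \<in> Obj A \<and>
     (\<forall>X \<in> Obj A. (\<exists>!f. f \<in> Hom A X Z) \<and> (\<exists>!f. f \<in> Hom A Z X))"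

definition biproduct :: "('o, 'm, 'x) additive_structure_scheme \<Rightarrow> 'o \<Rightarrow> 'o \<Rightarrow> 'o
    \<Rightarrow> 'm \<Rightarrow> 'm \<Rightarrow> 'm \<Rightarrow> 'm \<Rightarrow> bool" where
  "biproduct A X Y P i j p q \<longleftrightarrow> P \<in> Obj A \<and>
     i \<in> Hom A X P \<and> j \<in> Hom A Y P \<and> p \<in> Hom A P X \<and> q \<in> Hom A P Y \<and>
     p \<cdot>\<^bsub>A\<^esub> i = Id A X \<and> q \<cdot>\<^bsub>A\<^esub> j = Id A Y \<and>
     p \<cdot>\<^bsub>A\<^esub> j = \<zero>\<^bsub>hom_group A Y X\<^esub> \<and> q \<cdot>\<^bsub>A\<^esub> i = \<zero>\<^bsub>hom_group A X Y\<^esub> \<and>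
     (i \<cdot>\<^bsub>A\<^esub> p) \<oplus>\<^bsub>hom_group A P P\<^esub> (j \<cdot>\<^bsub>A\<^esub> q) = Id A P"

locale additive_category = preadditive_category A
  for A :: "('o, 'm, 'x) additive_structure_scheme" (structure) +
  assumes ex_zero_object: "\<exists>Z. zero_object A Z"
    and ex_biproduct: "X \<in> Obj A \<Longrightarrow> Y \<in> Obj A \<Longrightarrow> \<exists>P i j p q. biproduct A X Y P i j p q"

locale additive_functor = A: preadditive_category A + B: preadditive_category B + cat_functor A B F
  for A :: "('o1, 'm1, 'x) additive_structure_scheme"
    and B :: "('o2, 'm2, 'y) additive_structure_scheme"
    and F :: "('o1, 'm1, 'o2, 'm2) functor_data" +
  assumes AMap_add: "f \<in> Hom A X Y \<Longrightarrow> g \<in> Hom A X Y \<Longrightarrow>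
    AMap F (f \<oplus>\<^bsub>hom_group A X Y\<^esub> g)
      = AMap F f \<oplus>\<^bsub>hom_group B (OMap F X) (OMap F Y)\<^esub> AMap F g"

locale comonad =
    G: cat_functor A A G
  + delta: nat_trans A A G "comp_functor G G" \<delta>
  + epsilon: nat_trans A A G id_functor \<epsilon>
  for A :: "('o, 'm, 'x) category_scheme" (structure)
    and G :: "('o, 'm, 'o, 'm) functor_data"
    and \<delta> \<epsilon> :: "'o \<Rightarrow> 'm" +
  assumes coassoc: "M \<in> Obj A \<Longrightarrow> \<delta> (OMap G M) \<cdot> \<delta> M = AMap G (\<delta> M) \<cdot> \<delta> M"
    and counit_left: "M \<in> Obj A \<Longrightarrow> \<epsilon> (OMap G M) \<cdot> \<delta> M = Id A (OMap G M)"
    and counit_right: "M \<in> Obj A \<Longrightarrow> AMap G (\<epsilon> M) \<cdot> \<delta> M = Id A (OMap G M)"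

locale comonad_symmetry =
    comonad A G \<delta> \<epsilon>
  + t: nat_trans A A "comp_functor G G" "comp_functor G G" t
  for A :: "('o, 'm, 'x) category_scheme" (structure)
    and G :: "('o, 'm, 'o, 'm) functor_data"
    and \<delta> \<epsilon> t :: "'o \<Rightarrow> 'm" +
  assumes yang_baxter: "M \<in> Obj A \<Longrightarrow>
      AMap G (t M) \<cdot> t (OMap G M) \<cdot> AMap G (t M)
        = t (OMap G M) \<cdot> AMap G (t M) \<cdot> t (OMap G M)"
    and involutive: "M \<in> Obj A \<Longrightarrow> t M \<cdot> t M = Id A (OMap G (OMap G M))"
    and t_delta: "M \<in> Obj A \<Longrightarrow> t M \<cdot> \<delta> M = \<delta> M"
    and epsilon_t: "M \<in> Obj A \<Longrightarrow> \<epsilon> (OMap G M) \<cdot> t M = AMap G (\<epsilon> M)"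
    and delta_t: "M \<in> Obj A \<Longrightarrow>
      \<delta> (OMap G M) \<cdot> t M = AMap G (t M) \<cdot> t (OMap G M) \<cdot> AMap G (\<delta> M)"

definition comonad_tau ::
  "('o, 'm, 'x) additive_structure_scheme \<Rightarrow> ('o, 'm, 'o, 'm) functor_data
    \<Rightarrow> ('o \<Rightarrow> 'm) \<Rightarrow> ('o \<Rightarrow> 'm) \<Rightarrow> 'o \<Rightarrow> 'm" where
  "comonad_tau A G \<delta> \<epsilon> M =
     (let GGM = OMap G (OMap G M); E = hom_group A GGM GGM
      in (\<delta> M \<cdot>\<^bsub>A\<^esub> \<epsilon> (OMap G M)) \<oplus>\<^bsub>E\<^esub> (\<delta> M \<cdot>\<^bsub>A\<^esub> AMap G (\<epsilon> M)) \<ominus>\<^bsub>E\<^esub> Id A GGM)"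

end

theory Submission
  imports Defs
begin

text \<open>
  Write \<open>s = \<delta>\<^sub>M\<close>, \<open>e\<^sub>0 = \<epsilon>\<^bsub>GM\<^esub>\<close> and \<open>e\<^sub>1 = G \<epsilon>\<^sub>M\<close>, so that \<open>\<tau>\<^sub>M = s e\<^sub>0 + s e\<^sub>1 - 1\<close>. The counit laws say that
  \<open>e\<^sub>0\<close> and \<open>e\<^sub>1\<close> are two retractions of the same arrow \<open>s\<close>. For any arrow with two retractions, this
  expression is a reflection: it fixes \<open>s\<close>, and composing with it exchanges \<open>e\<^sub>0\<close> and \<open>e\<^sub>1\<close>. It is
  therefore an involution. This already gives \<open>\<tau>\<^sup>2 = 1\<close>, \<open>\<tau> \<delta> = \<delta>\<close> and \<open>\<epsilon>\<^sub>G \<tau> = G \<epsilon>\<close> (locale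
  \<open>two_retractions\<close>).

  The remaining two equations live on \<open>GGGM\<close>, with its arrows \<open>d\<^sub>0 = \<epsilon>\<^bsub>GGM\<^esub>\<close>, \<open>d\<^sub>1 = G \<epsilon>\<^bsub>GM\<^esub>\<close>,
  \<open>d\<^sub>2 = GG \<epsilon>\<^sub>M\<close> to \<open>GGM\<close> and \<open>s\<^sub>0 = \<delta>\<^bsub>GM\<^esub>\<close>, \<open>s\<^sub>1 = G \<delta>\<^sub>M\<close> from it. Because \<open>G\<close> is additive, both
  \<open>a = \<tau>\<^bsub>GM\<^esub>\<close> and \<open>b = G \<tau>\<^sub>M\<close> are again reflections: \<open>a = s\<^sub>0 d\<^sub>0 + s\<^sub>0 d\<^sub>1 - 1\<close> and
  \<open>b = s\<^sub>1 d\<^sub>1 + s\<^sub>1 d\<^sub>2 - 1\<close>. With \<open>t = \<tau>\<^sub>M\<close>, the one identity that needs the coassociativity law is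
  \<open>a s\<^sub>1 = b s\<^sub>0 t\<close> (lemma \<open>tau_G_degeneracies\<close>). Multiplying it by \<open>b\<close>, which is an involution, gives
  \<open>\<delta>\<^sub>G \<tau> = G(\<tau>) \<tau>\<^sub>G G(\<delta>)\<close>.

  For the Yang--Baxter equation, naturality of \<open>\<epsilon>\<close> and of \<open>\<tau>\<close> gives \<open>d\<^sub>0 b = t d\<^sub>0\<close> and
  \<open>d\<^sub>2 a = t d\<^sub>2\<close>. Expanding the middle factor and using \<open>a\<^sup>2 = b\<^sup>2 = t\<^sup>2 = 1\<close>,
  \<open>a b a = a s\<^sub>1 (d\<^sub>1 + d\<^sub>2) a - 1 = b s\<^sub>0 t (d\<^sub>0 + t d\<^sub>2) - 1 = b s\<^sub>0 (t d\<^sub>0 + d\<^sub>2) - 1\<close>, and likewise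
  \<open>b a b = b s\<^sub>0 (d\<^sub>0 + d\<^sub>1) b - 1 = b s\<^sub>0 (t d\<^sub>0 + d\<^sub>2) - 1\<close>.
\<close>

section \<open>Subtraction in hom-groups\<close>

text \<open>
  Bilinearity of composition and additivity of functors are stated for sums; this rule transfers
  them to the differences that occur in \<open>\<tau>\<close>.
\<close>

lemma additive_map_minus:
  assumes "abelian_group R" "abelian_group S"
    and h: "h \<in> carrier R \<rightarrow> carrier S"
    and add: "\<And>x y. x \<in> carrier R \<Longrightarrow> y \<in> carrier R \<Longrightarrow> h (x \<oplus>\<^bsub>R\<^esub> y) = h x \<oplus>\<^bsub>S\<^esub> h y"
    and x: "x \<in> carrier R" and y: "y \<in> carrier R"
  shows "h (x \<ominus>\<^bsub>R\<^esub> y) = h x \<ominus>\<^bsub>S\<^esub> h y"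
proof -
  interpret R: abelian_group R by fact
  interpret S: abelian_group S by fact
  have d: "x \<ominus>\<^bsub>R\<^esub> y \<in> carrier R" using x y by simp
  have hc: "h x \<in> carrier S" "h y \<in> carrier S" "h (x \<ominus>\<^bsub>R\<^esub> y) \<in> carrier S"
    using h x y d by blast+
  have "(x \<ominus>\<^bsub>R\<^esub> y) \<oplus>\<^bsub>R\<^esub> y = x"
    using x y by (simp add: R.minus_eq R.a_assoc R.l_neg)
  then have "h x = h (x \<ominus>\<^bsub>R\<^esub> y) \<oplus>\<^bsub>S\<^esub> h y"
    using add[OF d y] by simp
  then show ?thesis
    using hc by (simp add: S.minus_eq S.a_assoc S.r_neg)
qed

lemma (in abelian_group) common_summand_cancel:
  assumes "w \<in> carrier G" "x \<in> carrier G" "p \<in> carrier G" "q \<in> carrier G"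
  shows "(w \<ominus> q) \<oplus> x \<ominus> (w \<ominus> p) = x \<oplus> p \<ominus> q"
proof -
  have "(w \<ominus> q) \<oplus> x \<ominus> (w \<ominus> p) = (w \<oplus> \<ominus> w) \<oplus> (x \<oplus> p \<ominus> q)"
    using assms by (simp add: minus_eq minus_add a_ac minus_minus)
  then show ?thesis
    using assms by (simp add: r_neg)
qed

context preadditive_category
begin

lemma Hom_Obj:
  assumes "f \<in> Hom A X Y"
  shows "X \<in> Obj A" "Y \<in> Obj A"
  using assms Dom_in Cod_in unfolding Hom_def by auto

lemma carrier_hom_group: "carrier (hom_group A X Y) = Hom A X Y"
  by (simp add: hom_group_def)

lemma abelian_group_Hom:
  assumes "f \<in> Hom A X Y"
  shows "abelian_group (hom_group A X Y)"
  using hom_abelian_group Hom_Obj[OF assms] by blast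

lemma add_in_Hom:
  assumes "f \<in> Hom A X Y" "g \<in> Hom A X Y"
  shows "f \<oplus>\<^bsub>hom_group A X Y\<^esub> g \<in> Hom A X Y"
  using abelian_monoid.a_closed[OF abelian_group.axioms(1)[OF abelian_group_Hom[OF assms(1)]], of f g]
    assms by (simp add: carrier_hom_group)

lemma minus_in_Hom:
  assumes "f \<in> Hom A X Y" "g \<in> Hom A X Y"
  shows "f \<ominus>\<^bsub>hom_group A X Y\<^esub> g \<in> Hom A X Y"
  using abelian_group.minus_closed[OF abelian_group_Hom[OF assms(1)], of f g] assms
  by (simp add: carrier_hom_group)

lemma Comp_minus_left:
  assumes f: "f \<in> Hom A X Y" and g: "g \<in> Hom A Y Z" and h: "h \<in> Hom A Y Z"
  shows "(g \<ominus>\<^bsub>hom_group A Y Z\<^esub> h) \<cdot> f = (g \<cdot> f) \<ominus>\<^bsub>hom_group A X Z\<^esub> (h \<cdot> f)"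
  by (rule additive_map_minus[where h = "\<lambda>k. k \<cdot> f"])
    (use f g h Comp_in[OF f] Comp_add_left[OF f] abelian_group_Hom[OF g]
      abelian_group_Hom[OF Comp_in[OF f g]] in \<open>auto simp: carrier_hom_group\<close>)

lemma Comp_minus_right:
  assumes f: "f \<in> Hom A X Y" and g: "g \<in> Hom A X Y" and h: "h \<in> Hom A Y Z"
  shows "h \<cdot> (f \<ominus>\<^bsub>hom_group A X Y\<^esub> g) = (h \<cdot> f) \<ominus>\<^bsub>hom_group A X Z\<^esub> (h \<cdot> g)"
  by (rule additive_map_minus[where h = "\<lambda>k. h \<cdot> k"])
    (use f g h Comp_in[OF _ h] Comp_add_right[OF _ _ h] abelian_group_Hom[OF f]
      abelian_group_Hom[OF Comp_in[OF f h]] in \<open>auto simp: carrier_hom_group\<close>)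

end

lemma (in additive_functor) AMap_minus:
  assumes f: "f \<in> Hom A X Y" and g: "g \<in> Hom A X Y"
  shows "AMap F (f \<ominus>\<^bsub>hom_group A X Y\<^esub> g)
    = AMap F f \<ominus>\<^bsub>hom_group B (OMap F X) (OMap F Y)\<^esub> AMap F g"
  by (rule additive_map_minus[where h = "AMap F"])
    (use f g AMap_in AMap_add A.abelian_group_Hom[OF f] B.abelian_group_Hom[OF AMap_in[OF f]]
      in \<open>auto simp: A.carrier_hom_group B.carrier_hom_group\<close>)

section \<open>The reflection attached to two retractions of one arrow\<close>

definition reflection ::
  "('o, 'm, 'x) additive_structure_scheme \<Rightarrow> 'o \<Rightarrow> 'm \<Rightarrow> 'm \<Rightarrow> 'm \<Rightarrow> 'm" where
  "reflection A X s d d' =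
     (s \<cdot>\<^bsub>A\<^esub> d) \<oplus>\<^bsub>hom_group A X X\<^esub> (s \<cdot>\<^bsub>A\<^esub> d') \<ominus>\<^bsub>hom_group A X X\<^esub> Id A X"

locale two_retractions = preadditive_category A
  for A :: "('o, 'm, 'x) additive_structure_scheme" (structure) +
  fixes X Y :: 'o and s d d' :: 'm
  assumes s_in: "s \<in> Hom A Y X" and d_in: "d \<in> Hom A X Y" and d'_in: "d' \<in> Hom A X Y"
    and d_s: "d \<cdot> s = Id A Y" and d'_s: "d' \<cdot> s = Id A Y"
begin

abbreviation r :: 'm where "r \<equiv> reflection A X s d d'"

lemma Id_X_in: "Id A X \<in> Hom A X X"
  using Hom_Obj[OF s_in] Id_in by blast

lemma sd_in: "s \<cdot> d \<in> Hom A X X" "s \<cdot> d' \<in> Hom A X X"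
  using Comp_in s_in d_in d'_in by blast+

lemma reflection_in: "r \<in> Hom A X X"
  unfolding reflection_def by (intro minus_in_Hom add_in_Hom sd_in Id_X_in)

lemma reflection_Comp:
  assumes f: "f \<in> Hom A W X"
  shows "r \<cdot> f =
    (s \<cdot> d \<cdot> f) \<oplus>\<^bsub>hom_group A W X\<^esub> (s \<cdot> d' \<cdot> f) \<ominus>\<^bsub>hom_group A W X\<^esub> f"
  unfolding reflection_def
  using Comp_minus_left[OF f add_in_Hom[OF sd_in] Id_X_in] Comp_add_left[OF f sd_in]
    Id_Comp[OF f] Comp_assoc[OF f d_in s_in] Comp_assoc[OF f d'_in s_in]
  by simp

lemma Comp_reflection:
  assumes g: "g \<in> Hom A X Z"
  shows "g \<cdot> r =
    (g \<cdot> s \<cdot> d) \<oplus>\<^bsub>hom_group A X Z\<^esub> (g \<cdot> s \<cdot> d') \<ominus>\<^bsub>hom_group A X Z\<^esub> g"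
  unfolding reflection_def
  using Comp_minus_right[OF add_in_Hom[OF sd_in] Id_X_in g] Comp_add_right[OF sd_in g]
    Comp_Id[OF g]
  by simp

lemma reflection_s: "r \<cdot> s = s"
proof -
  interpret H: abelian_group "hom_group A Y X"
    using s_in by (rule abelian_group_Hom)
  have s: "s \<in> carrier (hom_group A Y X)" using s_in by (simp add: carrier_hom_group)
  show ?thesis
    using s by (simp add: reflection_Comp[OF s_in] d_s d'_s Comp_Id[OF s_in]
        H.minus_eq H.a_assoc H.r_neg)
qed

text \<open>
  Composing with the reflection exchanges the two retractions: each of them turns \<open>s d + s d'\<close> into
  \<open>d + d'\<close>, and subtracting one retraction leaves the other.
\<close>

lemma
  shows d_reflection: "d \<cdot> r = d'" and d'_reflection: "d' \<cdot> r = d"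
proof -
  interpret H: abelian_group "hom_group A X Y"
    using d_in by (rule abelian_group_Hom)
  have car: "d \<in> carrier (hom_group A X Y)" "d' \<in> carrier (hom_group A X Y)"
    using d_in d'_in by (simp_all add: carrier_hom_group)
  have eq: "d \<cdot> s \<cdot> d = d" "d \<cdot> s \<cdot> d' = d'" "d' \<cdot> s \<cdot> d = d" "d' \<cdot> s \<cdot> d' = d'"
    using Comp_assoc[OF d_in s_in d_in] Comp_assoc[OF d_in s_in d'_in]
      Comp_assoc[OF d'_in s_in d_in] Comp_assoc[OF d'_in s_in d'_in]
      Id_Comp[OF d_in] Id_Comp[OF d'_in] d_s d'_s by simp_all
  show "d \<cdot> r = d'"
    using car by (simp add: Comp_reflection[OF d_in] eq H.minus_eq H.a_assoc H.r_neg
        H.a_comm[of d d'])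
  show "d' \<cdot> r = d"
    using car by (simp add: Comp_reflection[OF d'_in] eq H.minus_eq H.a_assoc H.r_neg)
qed

text \<open>
  Exchanging the two retractions does not change \<open>s d + s d'\<close>, so \<open>r r = (s d' + s d) - r\<close>, which is
  \<open>1\<close> because \<open>s d + s d' = r + 1\<close>.
\<close>

lemma reflection_involutive: "r \<cdot> r = Id A X"
proof -
  interpret H: abelian_group "hom_group A X X"
    using Id_X_in by (rule abelian_group_Hom)
  have car: "s \<cdot> d \<in> carrier (hom_group A X X)" "s \<cdot> d' \<in> carrier (hom_group A X X)"
    "Id A X \<in> carrier (hom_group A X X)"
    using sd_in Id_X_in by (simp_all add: carrier_hom_group)
  have "r \<cdot> r = (s \<cdot> d') \<oplus>\<^bsub>hom_group A X X\<^esub> (s \<cdot> d) \<ominus>\<^bsub>hom_group A X X\<^esub> r"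
    by (simp add: reflection_Comp[OF reflection_in] d_reflection d'_reflection)
  also have "\<dots> = Id A X"
    unfolding reflection_def using car
    by (simp add: H.minus_eq H.minus_add H.a_ac H.minus_minus H.r_neg H.r_neg1 H.r_neg2)
  finally show ?thesis .
qed

end

section \<open>Additive comonads\<close>

locale additive_comonad =
    additive_functor A A G + comonad A G \<delta> \<epsilon>
  for A :: "('o, 'm, 'x) additive_structure_scheme" (structure)
    and G :: "('o, 'm, 'o, 'm) functor_data"
    and \<delta> \<epsilon> :: "'o \<Rightarrow> 'm"
begin

abbreviation \<tau> :: "'o \<Rightarrow> 'm" where "\<tau> \<equiv> comonad_tau A G \<delta> \<epsilon>"

lemma tau_reflection:
  "\<tau> M = reflection A (OMap G (OMap G M)) (\<delta> M) (\<epsilon> (OMap G M)) (AMap G (\<epsilon> M))"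
  by (simp add: comonad_tau_def reflection_def Let_def)

lemma delta_in: "M \<in> Obj A \<Longrightarrow> \<delta> M \<in> Hom A (OMap G M) (OMap G (OMap G M))"
  using delta.component_in by (simp add: comp_functor_def)

lemma epsilon_in: "M \<in> Obj A \<Longrightarrow> \<epsilon> M \<in> Hom A (OMap G M) M"
  using epsilon.component_in by (simp add: id_functor_def)

lemma delta_natural: "f \<in> Hom A M N \<Longrightarrow> \<delta> N \<cdot> AMap G f = AMap G (AMap G f) \<cdot> \<delta> M"
  using delta.naturality by (simp add: comp_functor_def)

lemma epsilon_natural: "f \<in> Hom A M N \<Longrightarrow> \<epsilon> N \<cdot> AMap G f = f \<cdot> \<epsilon> M"
  using epsilon.naturality by (simp add: id_functor_def)

lemma two_retractions_tau:
  assumes M: "M \<in> Obj A"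
  shows "two_retractions A (OMap G (OMap G M)) (OMap G M) (\<delta> M) (\<epsilon> (OMap G M)) (AMap G (\<epsilon> M))"
  by unfold_locales
    (use M delta_in epsilon_in AMap_in OMap_in counit_left counit_right in auto)

text \<open>
  This is where additivity of \<open>G\<close> enters: it makes \<open>G \<tau>\<^sub>M\<close> a reflection too, so that all facts about
  \<open>two_retractions\<close> apply to it.
\<close>

lemma AMap_reflection:
  assumes "two_retractions A X Y s d d'"
  shows "AMap G (reflection A X s d d')
      = reflection A (OMap G X) (AMap G s) (AMap G d) (AMap G d')" (is ?eq)
    and "two_retractions A (OMap G X) (OMap G Y) (AMap G s) (AMap G d) (AMap G d')" (is ?tr)
proof -
  interpret R: two_retractions A X Y s d d' by fact
  note Y = A.Hom_Obj(1)[OF R.s_in] and X = A.Hom_Obj(2)[OF R.s_in]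
  show ?eq
    unfolding reflection_def
    using AMap_minus[OF A.add_in_Hom[OF R.sd_in] R.Id_X_in] AMap_add[OF R.sd_in]
      AMap_Comp[OF R.d_in R.s_in] AMap_Comp[OF R.d'_in R.s_in] AMap_Id[OF X]
    by simp
  show ?tr
    by unfold_locales
      (use AMap_in R.s_in R.d_in R.d'_in R.d_s R.d'_s AMap_Id[OF Y]
        AMap_Comp[OF R.s_in R.d_in] AMap_Comp[OF R.s_in R.d'_in] in auto)
qed

lemma tau_in:
  assumes "M \<in> Obj A"
  shows "\<tau> M \<in> Hom A (OMap G (OMap G M)) (OMap G (OMap G M))"
  unfolding tau_reflection
  by (rule two_retractions.reflection_in[OF two_retractions_tau[OF assms]])

text \<open>
  Since \<open>\<epsilon>\<^sub>G\<close>, \<open>G \<epsilon>\<close> and \<open>\<delta>\<close> are natural and composition is bilinear, \<open>GGf\<close> can be moved past each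
  of the three summands of \<open>\<tau>\<close>.
\<close>

lemma tau_natural:
  assumes f: "f \<in> Hom A M N"
  shows "\<tau> N \<cdot> AMap G (AMap G f) = AMap G (AMap G f) \<cdot> \<tau> M"
proof -
  note M = A.Hom_Obj(1)[OF f] and N = A.Hom_Obj(2)[OF f]
  interpret RM: two_retractions A "OMap G (OMap G M)" "OMap G M" "\<delta> M" "\<epsilon> (OMap G M)" "AMap G (\<epsilon> M)"
    using M by (rule two_retractions_tau)
  interpret RN: two_retractions A "OMap G (OMap G N)" "OMap G N" "\<delta> N" "\<epsilon> (OMap G N)" "AMap G (\<epsilon> N)"
    using N by (rule two_retractions_tau)
  note Gf = AMap_in[OF f]
  note GGf = AMap_in[OF Gf]
  have 1: "\<epsilon> (OMap G N) \<cdot> AMap G (AMap G f) = AMap G f \<cdot> \<epsilon> (OMap G M)"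
    using epsilon_natural[OF Gf] .
  have 2: "AMap G (\<epsilon> N) \<cdot> AMap G (AMap G f) = AMap G f \<cdot> AMap G (\<epsilon> M)"
    using AMap_Comp[OF Gf epsilon_in[OF N]] AMap_Comp[OF epsilon_in[OF M] f]
      epsilon_natural[OF f] by simp
  have 3: "\<delta> N \<cdot> AMap G f \<cdot> g = AMap G (AMap G f) \<cdot> \<delta> M \<cdot> g"
    if g: "g \<in> Hom A (OMap G (OMap G M)) (OMap G M)" for g
    using A.Comp_assoc[OF g Gf RN.s_in] A.Comp_assoc[OF g RM.s_in GGf] delta_natural[OF f]
    by simp
  show ?thesis
    unfolding tau_reflection
    by (simp add: RN.reflection_Comp[OF GGf] RM.Comp_reflection[OF GGf] 1 2
        3[OF RM.d_in] 3[OF RM.d'_in])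
qed

end

section \<open>The equations on \<open>GGGM\<close>\<close>

text \<open>
  The arrows \<open>e\<^sub>i\<close>, \<open>d\<^sub>i\<close> are the faces, and \<open>s\<close>, \<open>s\<^sub>i\<close> the degeneracies, of the simplicial object
  \<open>GM, GGM, GGGM, \<dots>\<close> that the comonad attaches to \<open>M\<close>.
\<close>

locale additive_comonad_at = additive_comonad A G \<delta> \<epsilon>
  for A :: "('o, 'm, 'x) additive_structure_scheme" (structure)
    and G :: "('o, 'm, 'o, 'm) functor_data"
    and \<delta> \<epsilon> :: "'o \<Rightarrow> 'm" +
  fixes M :: 'o
  assumes M: "M \<in> Obj A"
begin

abbreviation "G1 \<equiv> OMap G M"
abbreviation "G2 \<equiv> OMap G G1"
abbreviation "G3 \<equiv> OMap G G2"

abbreviation "s \<equiv> \<delta> M"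
abbreviation "e0 \<equiv> \<epsilon> G1"
abbreviation "e1 \<equiv> AMap G (\<epsilon> M)"
abbreviation "s0 \<equiv> \<delta> G1"
abbreviation "s1 \<equiv> AMap G (\<delta> M)"
abbreviation "d0 \<equiv> \<epsilon> G2"
abbreviation "d1 \<equiv> AMap G (\<epsilon> G1)"
abbreviation "d2 \<equiv> AMap G (AMap G (\<epsilon> M))"
abbreviation "t \<equiv> \<tau> M"
abbreviation "a \<equiv> \<tau> G1"
abbreviation "b \<equiv> AMap G (\<tau> M)"

lemma G1: "G1 \<in> Obj A" and G2: "G2 \<in> Obj A"
  using M OMap_in by auto

sublocale T: two_retractions A G2 G1 s e0 e1
  using M by (rule two_retractions_tau)

sublocale A3: two_retractions A G3 G2 s0 d0 d1
  using G1 by (rule two_retractions_tau)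

sublocale B3: two_retractions A G3 G2 s1 d1 d2
  using AMap_reflection(2)[OF T.two_retractions_axioms] .

lemma b_reflection: "b = B3.r"
  unfolding tau_reflection by (rule AMap_reflection(1)[OF T.two_retractions_axioms])

lemmas t_in = tau_in[OF M] and a_in = tau_in[OF G1]

lemma b_in: "b \<in> Hom A G3 G3"
  using AMap_in[OF t_in] .

lemma b_b: "b \<cdot> b = Id A G3"
  unfolding b_reflection by (rule B3.reflection_involutive)

lemma t_t: "t \<cdot> t = Id A G2"
  unfolding tau_reflection by (rule T.reflection_involutive)

lemma d0_s1: "d0 \<cdot> s1 = s \<cdot> e0"
  using epsilon_natural[OF T.s_in] .

lemma d2_s0: "d2 \<cdot> s0 = s \<cdot> e1"
  using delta_natural[OF epsilon_in[OF M]] by simp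

lemma d0_b: "d0 \<cdot> b = t \<cdot> d0"
  using epsilon_natural[OF t_in] .

lemma d2_a: "d2 \<cdot> a = t \<cdot> d2"
  using tau_natural[OF epsilon_in[OF M]] by simp

text \<open>
  Both sides equal \<open>s\<^sub>0 + \<sigma> e\<^sub>0 - s\<^sub>1\<close>, where \<open>\<sigma> = s\<^sub>0 s = s\<^sub>1 s\<close> by coassociativity. On the right,
  \<open>b s\<^sub>0 t = s\<^sub>1 t + \<sigma> e\<^sub>1 t - s\<^sub>0 t\<close>, where \<open>e\<^sub>1 t = e\<^sub>0\<close>, and the terms \<open>\<sigma> (e\<^sub>0 + e\<^sub>1)\<close> of \<open>s\<^sub>1 t\<close> and
  \<open>s\<^sub>0 t\<close> cancel.
\<close>

lemma tau_G_degeneracies: "a \<cdot> s1 = b \<cdot> s0 \<cdot> t"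
proof -
  let ?H = "hom_group A G2 G3"
  let ?x = "s0 \<cdot> s \<cdot> e0" and ?y = "s0 \<cdot> s \<cdot> e1"
  interpret H: abelian_group ?H
    using A3.s_in by (rule A.abelian_group_Hom)
  have car: "s0 \<in> carrier ?H" "s1 \<in> carrier ?H" "?x \<in> carrier ?H" "?y \<in> carrier ?H"
    using A3.s_in B3.s_in A.Comp_in[OF T.sd_in(1) A3.s_in] A.Comp_in[OF T.sd_in(2) A3.s_in]
    by (simp_all add: A.carrier_hom_group)
  have s1s: "s1 \<cdot> s \<cdot> g = s0 \<cdot> s \<cdot> g" if g: "g \<in> Hom A W G1" for g W
    using A.Comp_assoc[OF g T.s_in A3.s_in] A.Comp_assoc[OF g T.s_in B3.s_in] coassoc[OF M]
    by simp
  have lhs: "a \<cdot> s1 = ?x \<oplus>\<^bsub>?H\<^esub> s0 \<ominus>\<^bsub>?H\<^esub> s1"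
    unfolding tau_reflection
    by (simp add: A3.reflection_Comp[OF B3.s_in] d0_s1 B3.d_s A.Comp_Id[OF A3.s_in])
  have s0t_in: "s0 \<cdot> t \<in> Hom A G2 G3"
    using A.Comp_in[OF t_in A3.s_in] .
  have d1: "d1 \<cdot> s0 \<cdot> t = t"
    using A.Comp_assoc[OF t_in A3.s_in A3.d'_in] A3.d'_s A.Id_Comp[OF t_in] by simp
  have "d2 \<cdot> s0 \<cdot> t = s \<cdot> e1 \<cdot> t"
    using A.Comp_assoc[OF t_in A3.s_in B3.d'_in] A.Comp_assoc[OF t_in T.d'_in T.s_in] d2_s0
    by simp
  then have d2: "d2 \<cdot> s0 \<cdot> t = s \<cdot> e0"
    using T.d'_reflection by (simp add: tau_reflection)
  have s1t: "s1 \<cdot> t = ?x \<oplus>\<^bsub>?H\<^esub> ?y \<ominus>\<^bsub>?H\<^esub> s1"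
    unfolding tau_reflection
    by (simp add: T.Comp_reflection[OF B3.s_in] s1s[OF T.d_in] s1s[OF T.d'_in])
  have s0t: "s0 \<cdot> t = ?x \<oplus>\<^bsub>?H\<^esub> ?y \<ominus>\<^bsub>?H\<^esub> s0"
    unfolding tau_reflection by (simp add: T.Comp_reflection[OF A3.s_in])
  have "b \<cdot> s0 \<cdot> t = (s1 \<cdot> t) \<oplus>\<^bsub>?H\<^esub> ?x \<ominus>\<^bsub>?H\<^esub> (s0 \<cdot> t)"
    unfolding b_reflection using B3.reflection_Comp[OF s0t_in]
    by (simp add: d1 d2 s1s[OF T.d_in])
  also have "\<dots> = ?x \<oplus>\<^bsub>?H\<^esub> s0 \<ominus>\<^bsub>?H\<^esub> s1"
    unfolding s1t s0t using car by (intro H.common_summand_cancel H.a_closed)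
  finally show ?thesis
    using lhs by simp
qed

lemma delta_tau: "s0 \<cdot> t = b \<cdot> a \<cdot> s1"
proof -
  have s0t_in: "s0 \<cdot> t \<in> Hom A G2 G3"
    using A.Comp_in[OF t_in A3.s_in] .
  have "b \<cdot> a \<cdot> s1 = (b \<cdot> b) \<cdot> s0 \<cdot> t"
    using A.Comp_assoc[OF s0t_in b_in b_in] tau_G_degeneracies by simp
  then show ?thesis
    using A.Id_Comp[OF s0t_in] b_b by simp
qed

lemma yang_baxter_tau: "b \<cdot> a \<cdot> b = a \<cdot> b \<cdot> a"
proof -
  let ?H = "hom_group A G3 G3"
  \<comment> \<open>the common value of both sides: expand the middle factor on the left and on the right\<close>
  let ?v = "(b \<cdot> s0 \<cdot> t \<cdot> d0) \<oplus>\<^bsub>?H\<^esub> (b \<cdot> s0 \<cdot> d2) \<ominus>\<^bsub>?H\<^esub> Id A G3"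
  interpret H: abelian_group ?H
    using a_in by (rule A.abelian_group_Hom)
  note comp = A.Comp_in
  have td0: "t \<cdot> d0 \<in> Hom A G3 G2" and td2: "t \<cdot> d2 \<in> Hom A G3 G2"
    using comp[OF A3.d_in t_in] comp[OF B3.d'_in t_in] by blast+
  have aa: "a \<cdot> a = Id A G3"
    unfolding tau_reflection by (rule A3.reflection_involutive)
  have ab: "a \<cdot> b = (s0 \<cdot> t \<cdot> d0) \<oplus>\<^bsub>?H\<^esub> (s0 \<cdot> d2) \<ominus>\<^bsub>?H\<^esub> b"
    using A3.reflection_Comp[OF b_in] d0_b B3.d_reflection
    by (simp add: tau_reflection[of G1] flip: b_reflection)
  have "b \<cdot> a \<cdot> b = ?v"
    unfolding ab
    using A.Comp_minus_right[OF A.add_in_Hom[OF comp[OF td0 A3.s_in] comp[OF B3.d'_in A3.s_in]] b_in b_in]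
      A.Comp_add_right[OF comp[OF td0 A3.s_in] comp[OF B3.d'_in A3.s_in] b_in] b_b
    by simp
  moreover
  have d1a: "d1 \<cdot> a = d0"
    unfolding tau_reflection by (rule A3.d'_reflection)
  have ba: "b \<cdot> a = (s1 \<cdot> d0) \<oplus>\<^bsub>?H\<^esub> (s1 \<cdot> t \<cdot> d2) \<ominus>\<^bsub>?H\<^esub> a"
    using B3.reflection_Comp[OF a_in] d2_a d1a by (simp flip: b_reflection)
  have as1: "a \<cdot> s1 \<cdot> g = b \<cdot> s0 \<cdot> t \<cdot> g" if g: "g \<in> Hom A G3 G2" for g
    using A.Comp_assoc[OF g B3.s_in a_in] A.Comp_assoc[OF g comp[OF t_in A3.s_in] b_in]
      A.Comp_assoc[OF g t_in A3.s_in] tau_G_degeneracies by simp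
  have ttd2: "t \<cdot> t \<cdot> d2 = d2"
    using A.Comp_assoc[OF B3.d'_in t_in t_in] t_t A.Id_Comp[OF B3.d'_in] by simp
  have "a \<cdot> b \<cdot> a = ?v"
    unfolding ba
    using A.Comp_minus_right[OF A.add_in_Hom[OF comp[OF A3.d_in B3.s_in] comp[OF td2 B3.s_in]] a_in a_in]
      A.Comp_add_right[OF comp[OF A3.d_in B3.s_in] comp[OF td2 B3.s_in] a_in] aa
      as1[OF A3.d_in] as1[OF td2] ttd2
    by simp
  ultimately show ?thesis by simp
qed

end

theorem proposition1:
  fixes A :: "('o, 'm, 'x) additive_structure_scheme"
    and G :: "('o, 'm, 'o, 'm) functor_data"
    and \<delta> \<epsilon> :: "'o \<Rightarrow> 'm"
  assumes "additive_category A"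
    and "comonad A G \<delta> \<epsilon>"
    and "additive_functor A A G"
  shows "comonad_symmetry A G \<delta> \<epsilon> (comonad_tau A G \<delta> \<epsilon>)"
proof -
  interpret additive_comonad A G \<delta> \<epsilon>
    using assms by (intro additive_comonad.intro)
  have at: "additive_comonad_at A G \<delta> \<epsilon> M" if "M \<in> Obj A" for M
    by unfold_locales (rule that)
  show ?thesis
  proof unfold_locales
    fix M assume M: "M \<in> Obj A"
    interpret additive_comonad_at A G \<delta> \<epsilon> M using M by (rule at)
    show "\<tau> M \<in> Hom A (OMap (comp_functor G G) M) (OMap (comp_functor G G) M)"
      using t_in by (simp add: comp_functor_def)
    show "b \<cdot>\<^bsub>A\<^esub> a \<cdot>\<^bsub>A\<^esub> b = a \<cdot>\<^bsub>A\<^esub> b \<cdot>\<^bsub>A\<^esub> a" by (rule yang_baxter_tau)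
    show "t \<cdot>\<^bsub>A\<^esub> t = Id A G2" by (rule t_t)
    show "t \<cdot>\<^bsub>A\<^esub> s = s" unfolding tau_reflection by (rule T.reflection_s)
    show "e0 \<cdot>\<^bsub>A\<^esub> t = e1" unfolding tau_reflection by (rule T.d_reflection)
    show "s0 \<cdot>\<^bsub>A\<^esub> t = b \<cdot>\<^bsub>A\<^esub> a \<cdot>\<^bsub>A\<^esub> s1" by (rule delta_tau)
  next
    fix f X Y assume "f \<in> Hom A X Y"
    then show "\<tau> Y \<cdot>\<^bsub>A\<^esub> AMap (comp_functor G G) f = AMap (comp_functor G G) f \<cdot>\<^bsub>A\<^esub> \<tau> X"
      using tau_natural by (simp add: comp_functor_def)
  qed
qed

end
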